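(* Let $V=\{v_1,\dots,v_n\}$ be a finite set of positive integers. Then each of the following three conditions is satisfied by infinitely many positive integers $w$ whose square-free part differs from the square-free part of $v_k$ for every $1\leq k\leq n$: (i) $w$ is an isolated vertex of $D(V\cup\{w\})$; (ii) for an arbitrarily prescribed $v_i\in V$, $w$ is linked in $D(V\cup\{w\})$ to $v_i$ and to no other vertex; (iii) for prescribed $v_i,v_j\in V$ ($i\neq j$) whose square-free parts are different, $w$ is linked in $D(V\cup\{w\})$ to exactly $v_i$ and $v_j$ and to no other vertex.
   Context: For a finite set $V$ of positive integers, the Diophantine graph $D(V)$ has vertex set $V$, and two distinct elements $a,b\in V$ are linked by an edge if and only if $ab+1$ is a perfect square. The square-free part of a positive integer $v$ is the unique square-free positive integer $s$ such that $v=sm^2$ for some positive integer $m$. *)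

theory Defs
  imports "HOL-Computational_Algebra.Computational_Algebra" "Graph_Theory.Pair_Digraph"
begin

text \<open>
  Undirected graphs are symmetric loop-free digraphs: an edge linking \<open>a\<close> and \<open>b\<close> is the pair
  of arcs \<open>(a, b)\<close> and \<open>(b, a)\<close>.
\<close>

definition diophantine_graph :: "nat set \<Rightarrow> nat pair_pre_digraph" where
  "diophantine_graph V =
     \<lparr> pverts = V, parcs = {(a, b). a \<in> V \<and> b \<in> V \<and> a \<noteq> b \<and> is_square (a * b + 1)} \<rparr>"

lemma pair_graph_diophantine_graph:
  assumes "finite V"
  shows "pair_graph (diophantine_graph V)"
proof
  show "finite (parcs (diophantine_graph V))"
    by (rule finite_subset[of _ "V \<times> V"]) (use assms in \<open>auto simp: diophantine_graph_def\<close>)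
  show "symmetric (with_proj (diophantine_graph V))"
    by (auto simp: symmetric_def sym_def diophantine_graph_def mult.commute)
qed (use assms in \<open>auto simp: diophantine_graph_def\<close>)

definition neighbours :: "'a pair_pre_digraph \<Rightarrow> 'a \<Rightarrow> 'a set" where
  "neighbours G v = {u. v \<rightarrow>\<^bsub>with_proj G\<^esub> u}"

definition isolated_vertex :: "'a pair_pre_digraph \<Rightarrow> 'a \<Rightarrow> bool" where
  "isolated_vertex G v \<longleftrightarrow> v \<in> pverts G \<and> neighbours G v = {}"

text \<open>
  The library's \<^const>\<open>squarefree_part\<close>, defined through \<^const>\<open>square_part\<close>, is the unique
  squarefree \<open>s\<close> with \<open>v = s m\<^sup>2\<close> for some positive \<open>m\<close>.
\<close>

lemma squarefree_part_unique:
  fixes v s :: nat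
  assumes "v > 0"
  shows "squarefree_part v = s \<longleftrightarrow> squarefree s \<and> (\<exists>m>0. v = s * m ^ 2)"
proof
  assume "squarefree_part v = s"
  moreover have "squarefree (squarefree_part v)"
    by (rule squarefree_squarefree_part)
  moreover have "v = squarefree_part v * square_part v ^ 2"
    by (rule squarefree_decompose)
  moreover have "square_part v > 0"
    using assms by (metis gr0I square_part_0_iff)
  ultimately show "squarefree s \<and> (\<exists>m>0. v = s * m ^ 2)"
    by blast
next
  assume "squarefree s \<and> (\<exists>m>0. v = s * m ^ 2)"
  then obtain m where s: "squarefree s" and m: "m > 0" "v = s * m ^ 2"
    by blast
  have "m dvd square_part v"
    by (simp add: dvd_square_part_iff m)
  then obtain k where k: "square_part v = m * k" ..
  have "square_part v ^ 2 dvd v" ..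
  hence "(m * k) ^ 2 dvd s * m ^ 2"
    by (metis k m(2))
  hence "k ^ 2 dvd s"
    using m(1) by (simp add: power_mult_distrib mult.commute[of s])
  hence "k = 1"
    using s by (auto simp: squarefree_def)
  thus "squarefree_part v = s"
    using assms k m by (simp add: squarefree_part_def)
qed

end

theory Submission
  imports Defs "HOL-Analysis.Kronecker_Approximation_Theorem"
begin

text \<open>
  For (i) and (ii), large primes \<open>p\<close> give \<open>w = p\<close> and \<open>w = p (p a + 2)\<close>: if \<open>p q + 1\<close> is a square
  then \<open>q = l (l p + 2)\<close> for some integer \<open>l\<close>, which is impossible for size reasons unless \<open>q\<close> is
  the intended value; and \<open>p\<close> divides the square-free part of \<open>w\<close>.

  For (iii), the Pell equation \<open>S\<^sup>2 = a b T\<^sup>2 + 1\<close> provides an exponentially growing sequence of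
  numbers \<open>w = T ((a + b) T + 2 S)\<close> linked to both \<open>a\<close> and \<open>b\<close>. Such a \<open>w\<close> is bad if \<open>c w + 1\<close>
  is a square for a further vertex \<open>c\<close>, or if \<open>c w\<close> is a square for some vertex \<open>c\<close>. With
  \<open>e \<in> {0, 1}\<close>, a bad \<open>w\<close> gives an integer point \<open>(x, y, z)\<close> with \<open>x\<^sup>2 = a w + 1\<close>, \<open>y\<^sup>2 = b w + 1\<close>,
  \<open>z\<^sup>2 = c w + e\<close>. These points lie on a nondegenerate conic of the projective plane, so three of
  them have a nonzero determinant. But \<open>(x, y, z)\<close> is within \<open>O(w\<^sup>-\<^sup>1\<^sup>/\<^sup>2)\<close> of the line spanned by
  \<open>(\<surd>a, \<surd>b, \<surd>c)\<close>, so the determinant would be smaller than 1 if the three values of \<open>w\<close> were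
  of comparable size. Hence each window of bounded length far out in the sequence contains at
  most two bad terms per constraint, and a sufficiently long window contains a good term.
\<close>

section \<open>Square-free parts and square products\<close>

text \<open>The square-free part records the parity of each prime exponent, and a product is a
  square iff these parities agree. This lets the condition on square-free parts be handled as
  non-squareness of \<open>w * v\<close>.\<close>

lemma is_square_mult_iff_squarefree_part_eq:
  fixes a b :: nat
  assumes "a > 0" "b > 0"
  shows "is_square (a * b) \<longleftrightarrow> squarefree_part a = squarefree_part b"
proof -
  have sf: "multiplicity p (squarefree_part n) = multiplicity p n mod 2" if "prime p" for p n :: nat
    using that by (rule prime_multiplicity_squarefree_part)
  have "is_square (a * b) \<longleftrightarrow> (\<forall>p. prime p \<longrightarrow> even (multiplicity p a + multiplicity p b))"
    using assms
    by (auto simp: is_nth_power_conv_multiplicity_nat prime_elem_multiplicity_mult_distrib)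
  also have "\<dots> \<longleftrightarrow> (\<forall>p. prime p \<longrightarrow>
      multiplicity p (squarefree_part a) = multiplicity p (squarefree_part b))"
    using assms by (intro all_cong1 imp_cong refl) (auto simp: sf mod2_eq_if)
  also have "\<dots> \<longleftrightarrow> squarefree_part a = squarefree_part b"
    using multiplicity_eq_nat[of "squarefree_part a" "squarefree_part b"] squarefree_part_nonzero
    by (metis neq0_conv)
  finally show ?thesis .
qed

section \<open>Pell's equation\<close>

lemma sqrt_irrational:
  assumes "\<not> is_square (D::nat)"
  shows "sqrt D \<notin> \<rat>"
proof
  assume "sqrt D \<in> \<rat>"
  then obtain m n :: nat where mn: "n \<noteq> 0" "\<bar>sqrt D\<bar> = m / n"
    by (rule Rats_abs_nat_div_natE)
  have "real D = (m / n) ^ 2"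
    using mn(2) by (metis abs_of_nonneg of_nat_0_le_iff real_sqrt_ge_zero real_sqrt_pow2)
  hence "real (D * n ^ 2) = real (m ^ 2)"
    using mn(1) by (simp add: field_simps)
  hence "D * n ^ 2 = m ^ 2"
    by (simp only: of_nat_eq_iff)
  hence "is_square (D * n ^ 2)"
    by simp
  moreover have "is_square (n ^ 2)" "n ^ 2 \<noteq> 0"
    using mn(1) by simp_all
  ultimately have "is_square D"
    using is_nth_power_mult_cancel_right by blast
  with assms show False by simp
qed

text \<open>Dirichlet approximations \<open>h / k\<close> of \<open>sqrt D\<close> have bounded norm
  h^2 - D k^2, so by pigeonhole one norm occurs infinitely often. It is not 0 because
  \<open>sqrt D\<close> is irrational.\<close>

lemma infinite_pell_type_solutions:
  assumes "\<not> is_square (D::nat)"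
  shows "\<exists>m::int. m \<noteq> 0 \<and> infinite {(h, k). k > 0 \<and> h\<^sup>2 - int D * k\<^sup>2 = m}"
proof -
  define A where "A = approx_set (sqrt D)"
  define f where "f = (\<lambda>(h::int, k::int). h\<^sup>2 - int D * k\<^sup>2)"
  define B where "B = \<lceil>2 * sqrt D + 1\<rceil>"
  have inf: "infinite A"
    using sqrt_irrational[OF assms] unfolding A_def rational_iff_finite_approx_set .
  have "f ` A \<subseteq> {-B..B}"
  proof (rule image_subsetI, clarify)
    fix h k assume hk: "(h, k) \<in> A"
    define d where "d = sqrt D - of_int h / of_int k"
    have k: "k > 0" and d: "\<bar>d\<bar> < 1 / k\<^sup>2"
      using hk by (auto simp: A_def approx_set_def d_def)
    have k1: "real_of_int k \<ge> 1"
      using k by simp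
    have h: "real_of_int h = k * (sqrt D - d)"
      using k by (simp add: d_def)
    have "real_of_int (f (h, k)) = (real_of_int h)\<^sup>2 - (sqrt D)\<^sup>2 * (real_of_int k)\<^sup>2"
      by (simp add: f_def)
    also have "\<dots> = k\<^sup>2 * (d * (d - 2 * sqrt D))"
      unfolding h by (simp add: power2_eq_square algebra_simps del: real_sqrt_mult_self)
    finally have "\<bar>real_of_int (f (h, k))\<bar> = (k\<^sup>2 * \<bar>d\<bar>) * \<bar>d - 2 * sqrt D\<bar>"
      by (simp add: abs_mult)
    also have "\<dots> \<le> 1 * (1 + 2 * sqrt D)"
    proof (rule mult_mono)
      show "k\<^sup>2 * \<bar>d\<bar> \<le> 1"
        using d k by (simp add: field_simps)
      have "1 / (real_of_int k)\<^sup>2 \<le> 1"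
        using k1 by simp
      hence "\<bar>d\<bar> \<le> 1"
        using d by simp
      thus "\<bar>d - 2 * sqrt D\<bar> \<le> 1 + 2 * sqrt D"
        using abs_triangle_ineq4[of d "2 * sqrt D"] by simp
    qed auto
    finally have "real_of_int \<bar>f (h, k)\<bar> \<le> 2 * sqrt D + 1"
      by simp
    hence "\<bar>f (h, k)\<bar> \<le> B"
      unfolding B_def by linarith
    thus "f (h, k) \<in> {-B..B}"
      by auto
  qed
  hence "finite (f ` A)"
    by (rule finite_subset) simp
  from pigeonhole_infinite[OF inf this]
  obtain p where p: "p \<in> A" "infinite {q \<in> A. f q = f p}" by blast
  have k0: "snd q > 0" if "q \<in> A" for q
    using that by (auto simp: A_def approx_set_def)
  show ?thesis
  proof (intro exI conjI)
    show "infinite {(h, k). k > 0 \<and> h\<^sup>2 - int D * k\<^sup>2 = f p}"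
      using p(2) by (rule infinite_super[rotated]) (auto simp: f_def dest: k0)
    show "f p \<noteq> 0"
    proof
      assume "f p = 0"
      hence "int D * (snd p)\<^sup>2 = (fst p)\<^sup>2"
        by (simp add: f_def case_prod_unfold)
      hence "real D * (real_of_int (snd p))\<^sup>2 = (real_of_int (fst p))\<^sup>2"
        by (metis of_int_mult of_int_of_nat_eq of_int_power)
      hence "sqrt D * \<bar>real_of_int (snd p)\<bar> = \<bar>real_of_int (fst p)\<bar>"
        by (metis real_sqrt_abs real_sqrt_mult)
      hence "sqrt D = \<bar>real_of_int (fst p)\<bar> / \<bar>real_of_int (snd p)\<bar>"
        using k0[OF p(1)] by (simp add: field_simps)
      hence "sqrt D \<in> \<rat>"
        by simp
      thus False
        using sqrt_irrational[OF assms] by contradiction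
    qed
  qed
qed

text \<open>Take two solutions of norm \<open>m\<close> congruent modulo \<open>m\<close>. The
  quotient of h' + k' sqrt D by h + k sqrt D is then x + y sqrt D with integral x, y, and has norm
  1.\<close>

lemma pell_solution:
  assumes "\<not> is_square (D::nat)"
  obtains s t :: nat where "s > 0" "t > 0" "s\<^sup>2 = D * t\<^sup>2 + 1"
proof -
  obtain m :: int where m: "m \<noteq> 0" and inf: "infinite {(h, k). k > 0 \<and> h\<^sup>2 - int D * k\<^sup>2 = m}"
    using infinite_pell_type_solutions[OF assms] by blast
  define A where "A = {(h, k). k > 0 \<and> h\<^sup>2 - int D * k\<^sup>2 = m}"
  define g where "g = (\<lambda>(h::int, k::int). (h mod \<bar>m\<bar>, k mod \<bar>m\<bar>))"
  have "g ` A \<subseteq> {0..<\<bar>m\<bar>} \<times> {0..<\<bar>m\<bar>}"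
    using m by (auto simp: g_def)
  hence "finite (g ` A)"
    by (rule finite_subset) simp
  from pigeonhole_infinite[OF inf[folded A_def] this]
  obtain p where p: "p \<in> A" and infp: "infinite {q \<in> A. g q = g p}" by blast
  have "infinite ({q \<in> A. g q = g p} - {p})"
    using infp by simp
  then obtain q where q: "q \<in> A" "g q = g p" "q \<noteq> p"
    using infinite_imp_nonempty by blast
  obtain h k where pe: "p = (h, k)" by fastforce
  obtain h' k' where qe: "q = (h', k')" by fastforce
  have k: "k > 0" "k' > 0" and n: "h\<^sup>2 - int D * k\<^sup>2 = m" "h'\<^sup>2 - int D * k'\<^sup>2 = m"
    using p q(1) by (auto simp: A_def pe qe)
  have dh: "m dvd h' - h" and dk: "m dvd k' - k"
    using q(2) by (auto simp: g_def pe qe mod_eq_dvd_iff)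
  \<comment> \<open>This is the rational part of (h' + k' sqrt D)(h - k sqrt D); replacing h', k' by
    h, k modulo \<open>m\<close> turns it into the norm \<open>m\<close> itself.\<close>
  have "m dvd h * h' - int D * k * k'"
  proof -
    have "h * h' - int D * k * k' = m + h * (h' - h) - int D * k * (k' - k)"
      by (simp add: n(1)[symmetric] algebra_simps power2_eq_square)
    thus ?thesis using dh dk by simp
  qed
  then obtain x where x: "h * h' - int D * k * k' = m * x" ..
  have "m dvd h * k' - h' * k"
  proof -
    have "h * k' - h' * k = h * (k' - k) - k * (h' - h)"
      by (simp add: algebra_simps)
    thus ?thesis using dh dk by simp
  qed
  then obtain y where y: "h * k' - h' * k = m * y" ..
  have "m\<^sup>2 * (x\<^sup>2 - int D * y\<^sup>2) = (m * x)\<^sup>2 - int D * (m * y)\<^sup>2"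
    by (simp add: algebra_simps power_mult_distrib)
  also have "\<dots> = (h\<^sup>2 - int D * k\<^sup>2) * (h'\<^sup>2 - int D * k'\<^sup>2)"
    unfolding x[symmetric] y[symmetric] by (simp add: algebra_simps power2_eq_square)
  also have "\<dots> = m\<^sup>2 * 1"
    unfolding n by (simp add: power2_eq_square)
  finally have pell: "x\<^sup>2 = int D * y\<^sup>2 + 1"
    using m by simp
  \<comment> \<open>Otherwise the two solutions are proportional; equal nonzero norms and positive
    \<open>k\<close>, \<open>k'\<close> then make them equal.\<close>
  have "y \<noteq> 0"
  proof
    assume "y = 0"
    hence proportional: "h * k' = h' * k"
      using y by simp
    have "m * k'\<^sup>2 = (h * k')\<^sup>2 - int D * k\<^sup>2 * k'\<^sup>2"
      by (simp add: n(1)[symmetric] algebra_simps power_mult_distrib)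
    also have "\<dots> = m * k\<^sup>2"
      by (simp add: proportional n(2)[symmetric] algebra_simps power_mult_distrib)
    finally have "k = k'"
      using m k by (simp add: power2_eq_iff)
    with proportional k have "h = h'"
      by simp
    with \<open>k = k'\<close> q(3) show False
      by (simp add: pe qe)
  qed
  show thesis
  proof (rule that[of "nat \<bar>x\<bar>" "nat \<bar>y\<bar>"])
    show "nat \<bar>y\<bar> > 0"
      using \<open>y \<noteq> 0\<close> by simp
    have "x \<noteq> 0"
    proof
      assume "x = 0"
      hence "int D * y\<^sup>2 + 1 = 0"
        using pell by simp
      moreover have "int D * y\<^sup>2 \<ge> 0"
        by simp
      ultimately show False by linarith
    qed
    thus "nat \<bar>x\<bar> > 0" by simp
    have "int ((nat \<bar>x\<bar>)\<^sup>2) = int (D * (nat \<bar>y\<bar>)\<^sup>2 + 1)"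
      by (simp add: pell)
    thus "(nat \<bar>x\<bar>)\<^sup>2 = D * (nat \<bar>y\<bar>)\<^sup>2 + 1"
      by (simp only: of_nat_eq_iff)
  qed
qed

text \<open>If S^2 = a b T^2 + 1, then w = T ((a + b) T + 2 S) satisfies a w + 1 = (a T + S)^2, and
  likewise for \<open>b\<close>. The bound on consecutive ratios keeps the terms of a window
  comparable.\<close>

lemma common_neighbours_family:
  fixes a b :: nat
  assumes pos: "a > 0" "b > 0" and nsq: "\<not> is_square (a * b)"
  obtains w :: "nat \<Rightarrow> nat" and K :: nat where "strict_mono w" "\<And>n. w n > 0"
    "\<And>n. w (Suc n) \<le> K * w n" "\<And>n. is_square (a * w n + 1)" "\<And>n. is_square (b * w n + 1)"
proof -
  obtain s t where st: "s > 0" "t > 0" "s\<^sup>2 = a * b * t\<^sup>2 + 1"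
    using pell_solution[OF nsq] .
  \<comment> \<open>Iterated multiplication of S + T sqrt(a b) by the solution s + t sqrt(a b),
    which preserves the norm 1.\<close>
  define P where "P n = ((\<lambda>(S, T). (s * S + a * b * t * T, t * S + s * T)) ^^ n) (s, t)" for n
  define S where "S n = fst (P n)" for n
  define T where "T n = snd (P n)" for n
  have S0: "S 0 = s" and T0: "T 0 = t"
    by (simp_all add: S_def T_def P_def)
  have SS: "S (Suc n) = s * S n + a * b * t * T n" and TS: "T (Suc n) = t * S n + s * T n" for n
    by (simp_all add: S_def T_def P_def case_prod_unfold)
  have pell: "(S n)\<^sup>2 = a * b * (T n)\<^sup>2 + 1" for n
  proof (induction n)
    case (Suc n)
    have "int ((S (Suc n))\<^sup>2) - int (a * b * (T (Suc n))\<^sup>2) =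
        (int (s\<^sup>2) - int (a * b * t\<^sup>2)) * (int ((S n)\<^sup>2) - int (a * b * (T n)\<^sup>2))"
      unfolding SS TS by (simp add: algebra_simps power2_eq_square)
    also have "\<dots> = 1"
      unfolding st(3) Suc.IH by simp
    finally have "int ((S (Suc n))\<^sup>2) = int (a * b * (T (Suc n))\<^sup>2 + 1)"
      by simp
    thus ?case
      by (simp only: of_nat_eq_iff)
  qed (simp add: S0 T0 st)
  have T_pos: "T n > 0" for n
    by (induction n) (use st in \<open>simp_all add: T0 TS\<close>)
  have T_le_S: "T n \<le> S n" for n
  proof (rule power2_nat_le_eq_le[THEN iffD1])
    have "1 * (T n)\<^sup>2 \<le> a * b * (T n)\<^sup>2"
      using pos by (intro mult_right_mono) (auto simp: Suc_le_eq)
    thus "(T n)\<^sup>2 \<le> (S n)\<^sup>2"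
      unfolding pell by linarith
  qed
  have S_le_T: "S n \<le> (a * b + 1) * T n" for n
  proof (rule power2_nat_le_eq_le[THEN iffD1])
    have "1 \<le> (T n)\<^sup>2"
      using T_pos[of n] by (simp add: Suc_le_eq)
    hence "(S n)\<^sup>2 \<le> 1 * ((a * b + 1) * (T n)\<^sup>2)"
      by (simp add: pell)
    also have "\<dots> \<le> (a * b + 1) * ((a * b + 1) * (T n)\<^sup>2)"
      by (intro mult_right_mono) auto
    finally show "(S n)\<^sup>2 \<le> ((a * b + 1) * T n)\<^sup>2"
      by (simp only: power2_eq_square mult_ac)
  qed
  define w where "w n = T n * ((a + b) * T n + 2 * S n)" for n
  \<comment> \<open>Each step multiplies \<open>S\<close> and \<open>T\<close> by at most
    \<open>K\<close>; \<open>w\<close> is a quadratic form in them, so it grows by at most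
    \<open>K ^ 2\<close>.\<close>
  define K where "K = s + t * (a * b + 1)"
  show thesis
  proof
    have S_mono: "S n \<le> S (Suc n)" and T_mono: "T n < T (Suc n)" for n
    proof -
      show "S n \<le> S (Suc n)"
        unfolding SS using st(1) by (simp add: trans_le_add1)
      have "T n \<le> s * T n" "0 < t * S n"
        using st T_pos[of n] T_le_S[of n] by simp_all
      thus "T n < T (Suc n)"
        unfolding TS by linarith
    qed
    show "strict_mono w"
    proof (rule strict_mono_Suc_iff[THEN iffD2], rule allI)
      fix n
      have "T n * ((a + b) * T n + 2 * S n) < T (Suc n) * ((a + b) * T n + 2 * S n)"
        using T_mono[of n] T_pos[of n] pos by simp
      also have "\<dots> \<le> T (Suc n) * ((a + b) * T (Suc n) + 2 * S (Suc n))"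
        using T_mono[of n] S_mono[of n] by (intro mult_left_mono add_mono) auto
      finally show "w n < w (Suc n)"
        by (simp add: w_def)
    qed
    show "w n > 0" for n
      using T_pos[of n] pos by (simp add: w_def)
    show "w (Suc n) \<le> K ^ 2 * w n" for n
    proof -
      have "T (Suc n) \<le> t * ((a * b + 1) * T n) + s * T n"
        unfolding TS using S_le_T[of n] by simp
      hence T: "T (Suc n) \<le> K * T n"
        by (simp add: K_def algebra_simps)
      have "S (Suc n) \<le> s * S n + a * b * t * S n"
        unfolding SS using T_le_S[of n] by simp
      hence S: "S (Suc n) \<le> K * S n"
        by (simp add: K_def algebra_simps)
      have "w (Suc n) \<le> (K * T n) * ((a + b) * (K * T n) + 2 * (K * S n))"
        unfolding w_def using S T by (intro mult_mono add_mono) auto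
      also have "\<dots> = K ^ 2 * w n"
        by (simp add: w_def algebra_simps power2_eq_square)
      finally show ?thesis .
    qed
    show "is_square (a * w n + 1)" for n
    proof
      show "a * w n + 1 = (a * T n + S n) ^ 2"
        using pell[of n] by (simp add: w_def power2_eq_square algebra_simps)
    qed
    show "is_square (b * w n + 1)" for n
    proof
      show "b * w n + 1 = (b * T n + S n) ^ 2"
        using pell[of n] by (simp add: w_def power2_eq_square algebra_simps)
    qed
  qed
qed

section \<open>Integer points with comparable parameters\<close>

text \<open>A line meets a nondegenerate conic in at most two points. If the third point is a
  combination of the other two, evaluating the quadratic form at it leaves only the mixed term, so
  the polar form \<open>B\<close> of the first two points vanishes.\<close>

lemma det_nonzero_on_conic:
  fixes l m n x1 x2 x3 y1 y2 y3 z1 z2 z3 :: int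
  assumes q: "l * x1\<^sup>2 + m * y1\<^sup>2 + n * z1\<^sup>2 = 0" "l * x2\<^sup>2 + m * y2\<^sup>2 + n * z2\<^sup>2 = 0"
             "l * x3\<^sup>2 + m * y3\<^sup>2 + n * z3\<^sup>2 = 0"
    and l: "l \<noteq> 0"
    and minors: "x1 * y2 \<noteq> x2 * y1" "x1 * y3 \<noteq> x3 * y1" "x2 * y3 \<noteq> x3 * y2"
             "x1 * z2 \<noteq> x2 * z1" "y1 * z2 \<noteq> y2 * z1"
  shows "x1 * (y2 * z3 - y3 * z2) - x2 * (y1 * z3 - y3 * z1) + x3 * (y1 * z2 - y2 * z1) \<noteq> 0"
proof
  assume det: "x1 * (y2 * z3 - y3 * z2) - x2 * (y1 * z3 - y3 * z1) + x3 * (y1 * z2 - y2 * z1) = 0"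
  \<comment> \<open>By Cramer's rule these are the coefficients of a linear relation between the
    three points; only its third coordinate needs \<open>det\<close>.\<close>
  define u1 where "u1 = x2 * y3 - x3 * y2"
  define u2 where "u2 = x3 * y1 - x1 * y3"
  define u3 where "u3 = x1 * y2 - x2 * y1"
  define B where "B = l * (x1 * x2) + m * (y1 * y2) + n * (z1 * z2)"
  have px: "u3 * x3 = - (u1 * x1 + u2 * x2)"
    by (simp add: u1_def u2_def u3_def algebra_simps)
  have py: "u3 * y3 = - (u1 * y1 + u2 * y2)"
    by (simp add: u1_def u2_def u3_def algebra_simps)
  have pz: "u3 * z3 = - (u1 * z1 + u2 * z2)"
    using det by (simp add: u1_def u2_def u3_def algebra_simps)
  have "0 = u3\<^sup>2 * (l * x3\<^sup>2 + m * y3\<^sup>2 + n * z3\<^sup>2)"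
    by (simp add: q)
  also have "\<dots> = l * (u3 * x3)\<^sup>2 + m * (u3 * y3)\<^sup>2 + n * (u3 * z3)\<^sup>2"
    by (simp add: algebra_simps power_mult_distrib)
  also have "\<dots> = u1\<^sup>2 * (l * x1\<^sup>2 + m * y1\<^sup>2 + n * z1\<^sup>2) +
      u2\<^sup>2 * (l * x2\<^sup>2 + m * y2\<^sup>2 + n * z2\<^sup>2) + 2 * u1 * u2 * B"
    unfolding px py pz B_def by (simp add: algebra_simps power2_eq_square)
  finally have "B = 0"
    using minors by (simp add: q u1_def u2_def)
  \<comment> \<open>\<open>(l, m, n)\<close> is now orthogonal to \<open>(x1\<^sup>2, y1\<^sup>2, z1\<^sup>2)\<close>, \<open>(x1 x2, y1 y2, z1 z2)\<close> and
    \<open>(x2\<^sup>2, y2\<^sup>2, z2\<^sup>2)\<close>, whose determinant is a product of \<open>2 \<times> 2\<close> minors.\<close>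
  have "l * ((x1 * y2 - x2 * y1) * (x1 * z2 - x2 * z1) * (y1 * z2 - y2 * z1)) =
      (l * x1\<^sup>2 + m * y1\<^sup>2 + n * z1\<^sup>2) * (y1 * y2 * z2\<^sup>2 - z1 * z2 * y2\<^sup>2) -
      B * (y1\<^sup>2 * z2\<^sup>2 - z1\<^sup>2 * y2\<^sup>2) +
      (l * x2\<^sup>2 + m * y2\<^sup>2 + n * z2\<^sup>2) * (y1\<^sup>2 * z1 * z2 - z1\<^sup>2 * y1 * y2)"
    unfolding B_def by (simp add: algebra_simps power2_eq_square)
  also have "\<dots> = 0"
    by (simp add: q \<open>B = 0\<close>)
  finally show False
    using l minors by simp
qed

text \<open>x^2 / y^2 is the Moebius function (p w + r) / (q w + s) of the parameter w, injective
  since its determinant p s - q r is nonzero.\<close>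

lemma ratio_injective:
  fixes p q r s u v x1 x2 y1 y2 :: int
  assumes "x1\<^sup>2 = p * u + r" "x2\<^sup>2 = p * v + r" "y1\<^sup>2 = q * u + s" "y2\<^sup>2 = q * v + s"
    and "p * s \<noteq> q * r" "u \<noteq> v"
  shows "x1 * y2 \<noteq> x2 * y1"
proof
  assume "x1 * y2 = x2 * y1"
  hence "x1\<^sup>2 * y2\<^sup>2 = x2\<^sup>2 * y1\<^sup>2"
    by (metis power_mult_distrib)
  hence "(p * s - q * r) * (u - v) = 0"
    unfolding assms(1-4) by (simp add: algebra_simps)
  with assms(5,6) show False by simp
qed

text \<open>Multiplying by the conjugate \<open>sqrt a * y + sqrt b * x\<close>, which is at least
  \<open>sqrt w\<close>, gives a y^2 - b x^2 = a e - b, a quantity free of \<open>w\<close>.\<close>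

lemma sqrt_combination_bound:
  fixes a b e w x y :: real
  assumes "a \<ge> 1" "b \<ge> 1" "w > 0" "0 \<le> e" "e \<le> 1" "x \<ge> 0" "y \<ge> 0"
    and x: "x\<^sup>2 = a * w + 1" and y: "y\<^sup>2 = b * w + e"
  shows "\<bar>sqrt a * y - sqrt b * x\<bar> \<le> (a + b) / sqrt w"
proof -
  have "sqrt w \<le> x"
    by (rule real_le_lsqrt) (use assms in \<open>auto simp: x intro: order_trans[of _ "a * w"]\<close>)
  also have "x \<le> sqrt b * x"
    using assms by (simp add: mult_le_cancel_right1)
  also have "\<dots> \<le> sqrt a * y + sqrt b * x"
    using assms by simp
  finally have ge: "sqrt w \<le> sqrt a * y + sqrt b * x" .
  have "\<bar>sqrt a * y - sqrt b * x\<bar> * sqrt w \<le> \<bar>sqrt a * y - sqrt b * x\<bar> * (sqrt a * y + sqrt b * x)"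
    using ge by (rule mult_left_mono) simp
  also have "\<dots> = \<bar>(sqrt a * y - sqrt b * x) * (sqrt a * y + sqrt b * x)\<bar>"
    using assms by (simp add: abs_mult)
  also have "(sqrt a * y - sqrt b * x) * (sqrt a * y + sqrt b * x) = a * y\<^sup>2 - b * x\<^sup>2"
    using assms by (simp add: algebra_simps power2_eq_square)
  also have "\<dots> = a * e - b"
    by (simp add: x y algebra_simps)
  also have "\<bar>a * e - b\<bar> \<le> a + b"
  proof -
    have "a * e \<le> a * 1" "0 \<le> a * e"
      using assms by (auto intro!: mult_left_mono simp del: mult_1_right)
    thus ?thesis using assms by linarith
  qed
  finally show ?thesis
    using assms by (simp add: field_simps)
qed

lemma det_bound:
  fixes X Y Z :: real
  assumes "\<bar>x1\<bar> \<le> X" "\<bar>x2\<bar> \<le> X" "\<bar>x3\<bar> \<le> X" "\<bar>y1\<bar> \<le> Y" "\<bar>y2\<bar> \<le> Y" "\<bar>y3\<bar> \<le> Y"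
    "\<bar>z1\<bar> \<le> Z" "\<bar>z2\<bar> \<le> Z" "\<bar>z3\<bar> \<le> Z"
  shows "\<bar>x1 * (y2 * z3 - y3 * z2) - x2 * (y1 * z3 - y3 * z1) + x3 * (y1 * z2 - y2 * z1)\<bar>
    \<le> 6 * (X * (Y * Z))"
proof -
  have triple: "\<bar>x * (y * z)\<bar> \<le> X * (Y * Z)" if "\<bar>x\<bar> \<le> X" "\<bar>y\<bar> \<le> Y" "\<bar>z\<bar> \<le> Z" for x y z
    unfolding abs_mult using that by (intro mult_mono) auto
  have "x1 * (y2 * z3 - y3 * z2) - x2 * (y1 * z3 - y3 * z1) + x3 * (y1 * z2 - y2 * z1) =
    x1 * (y2 * z3) - x1 * (y3 * z2) - x2 * (y1 * z3) + x2 * (y3 * z1) + x3 * (y1 * z2) - x3 * (y2 * z1)"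
    by (simp add: right_diff_distrib)
  moreover have "\<bar>x1 * (y2 * z3)\<bar> \<le> X * (Y * Z)" "\<bar>x1 * (y3 * z2)\<bar> \<le> X * (Y * Z)"
    "\<bar>x2 * (y1 * z3)\<bar> \<le> X * (Y * Z)" "\<bar>x2 * (y3 * z1)\<bar> \<le> X * (Y * Z)"
    "\<bar>x3 * (y1 * z2)\<bar> \<le> X * (Y * Z)" "\<bar>x3 * (y2 * z1)\<bar> \<le> X * (Y * Z)"
    by (rule triple; fact)+
  ultimately show ?thesis
    by linarith
qed

text \<open>
  The column operations defining \<open>\<eta>\<close> and \<open>\<zeta>\<close> below replace two columns of the determinant of the
  three points by columns of size \<open>O(W\<^sup>-\<^sup>1\<^sup>/\<^sup>2)\<close>.
\<close>

lemma three_solutions_gap: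
  fixes a b c e W W' w1 w2 w3 :: nat
  assumes pos: "a > 0" "b > 0" "c > 0" and ab: "a \<noteq> b" and e: "e \<le> 1" "c \<noteq> a * e" "c \<noteq> b * e"
    and W: "W > 0" "w1 \<in> {W..W'}" "w2 \<in> {W..W'}" "w3 \<in> {W..W'}"
    and distinct: "w1 \<noteq> w2" "w1 \<noteq> w3" "w2 \<noteq> w3"
    and sq: "\<And>w. w \<in> {w1, w2, w3} \<Longrightarrow>
      is_square (a * w + 1) \<and> is_square (b * w + 1) \<and> is_square (c * w + e)"
  shows "W\<^sup>2 \<le> (6 * (a + 1) * (a + b) * (a + c))\<^sup>2 * W'"
proof -
  have "\<forall>w\<in>{w1, w2, w3}. \<exists>x y z. x\<^sup>2 = a * w + 1 \<and> y\<^sup>2 = b * w + 1 \<and> z\<^sup>2 = c * w + e"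
    using sq unfolding is_nth_power_def by metis
  then obtain x y z where xyz: "\<And>w. w \<in> {w1, w2, w3} \<Longrightarrow>
      (x w)\<^sup>2 = a * w + 1 \<and> (y w)\<^sup>2 = b * w + 1 \<and> (z w)\<^sup>2 = c * w + e"
    by metis
  have ints: "(int (x w))\<^sup>2 = int a * int w + 1" "(int (y w))\<^sup>2 = int b * int w + 1"
      "(int (z w))\<^sup>2 = int c * int w + int e" if "w \<in> {w1, w2, w3}" for w
    using xyz[OF that] by (metis of_nat_1 of_nat_add of_nat_mult of_nat_power)+
  have reals: "(real (x w))\<^sup>2 = real a * real w + 1" "(real (y w))\<^sup>2 = real b * real w + 1"
      "(real (z w))\<^sup>2 = real c * real w + real e" if "w \<in> {w1, w2, w3}" for w
    using xyz[OF that] by (metis of_nat_1 of_nat_add of_nat_mult of_nat_power)+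
  define det where "det =
      int (x w1) * (int (y w2) * int (z w3) - int (y w3) * int (z w2)) -
      int (x w2) * (int (y w1) * int (z w3) - int (y w3) * int (z w1)) +
      int (x w3) * (int (y w1) * int (z w2) - int (y w2) * int (z w1))"
  have ne: "int a * 1 \<noteq> int b * 1" "int a * int e \<noteq> int c * 1" "int b * int e \<noteq> int c * 1"
    using ab e by (simp_all flip: of_nat_mult)
  have "det \<noteq> 0"
    unfolding det_def
  proof (rule det_nonzero_on_conic)
    \<comment> \<open>The coefficients form the cross product of (a, b, c) and (1, 1, e), which
      eliminates \<open>w\<close> from the three equations.\<close>
    have conic: "(int b * e - c) * (int (x w))\<^sup>2 + (int c - a * e) * (int (y w))\<^sup>2 +
        (int a - b) * (int (z w))\<^sup>2 = 0" if "w \<in> {w1, w2, w3}" for w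
      unfolding ints[OF that] by (simp add: algebra_simps)
    show "(int b * e - c) * (int (x w1))\<^sup>2 + (int c - a * e) * (int (y w1))\<^sup>2 +
        (int a - b) * (int (z w1))\<^sup>2 = 0"
      "(int b * e - c) * (int (x w2))\<^sup>2 + (int c - a * e) * (int (y w2))\<^sup>2 +
        (int a - b) * (int (z w2))\<^sup>2 = 0"
      "(int b * e - c) * (int (x w3))\<^sup>2 + (int c - a * e) * (int (y w3))\<^sup>2 +
        (int a - b) * (int (z w3))\<^sup>2 = 0"
      by (rule conic; simp)+
    show "int b * e - c \<noteq> 0"
      using ne by simp
    have xy: "int (x u) * int (y v) \<noteq> int (x v) * int (y u)"
      and xz: "int (x u) * int (z v) \<noteq> int (x v) * int (z u)"
      and yz: "int (y u) * int (z v) \<noteq> int (y v) * int (z u)"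
      if uv: "u \<in> {w1, w2, w3}" "v \<in> {w1, w2, w3}" "u \<noteq> v" for u v
    proof -
      have "int u \<noteq> int v"
        using uv(3) by simp
      then show "int (x u) * int (y v) \<noteq> int (x v) * int (y u)"
        "int (x u) * int (z v) \<noteq> int (x v) * int (z u)"
        "int (y u) * int (z v) \<noteq> int (y v) * int (z u)"
        by - (rule ratio_injective[OF ints(1)[OF uv(1)] ints(1)[OF uv(2)] ints(2)[OF uv(1)] ints(2)[OF uv(2)] ne(1)]
          ratio_injective[OF ints(1)[OF uv(1)] ints(1)[OF uv(2)] ints(3)[OF uv(1)] ints(3)[OF uv(2)] ne(2)]
          ratio_injective[OF ints(2)[OF uv(1)] ints(2)[OF uv(2)] ints(3)[OF uv(1)] ints(3)[OF uv(2)] ne(3)], assumption)+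
    qed
    show "int (x w1) * int (y w2) \<noteq> int (x w2) * int (y w1)"
      "int (x w1) * int (y w3) \<noteq> int (x w3) * int (y w1)"
      "int (x w2) * int (y w3) \<noteq> int (x w3) * int (y w2)"
      "int (x w1) * int (z w2) \<noteq> int (x w2) * int (z w1)"
      "int (y w1) * int (z w2) \<noteq> int (y w2) * int (z w1)"
      by (rule xy xz yz; use distinct in simp)+
  qed
  define \<eta> where "\<eta> w = sqrt a * y w - sqrt b * x w" for w
  define \<zeta> where "\<zeta> w = sqrt a * z w - sqrt c * x w" for w
  \<comment> \<open>Two columns are scaled by \<open>sqrt a\<close>, hence the factor
    \<open>a\<close>; subtracting multiples of the \<open>x\<close> column changes nothing.\<close>
  have det_eq: "a * real_of_int det =
      x w1 * (\<eta> w2 * \<zeta> w3 - \<eta> w3 * \<zeta> w2) - x w2 * (\<eta> w1 * \<zeta> w3 - \<eta> w3 * \<zeta> w1) +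
      x w3 * (\<eta> w1 * \<zeta> w2 - \<eta> w2 * \<zeta> w1)"
  proof -
    define A where "A = sqrt a"
    have "real a = A * A"
      by (simp add: A_def)
    thus ?thesis
      unfolding det_def \<eta>_def \<zeta>_def A_def[symmetric]
      by (simp add: algebra_simps)
  qed
  have range: "W \<le> w" "w \<le> W'" if "w \<in> {w1, w2, w3}" for w
    using that W by auto
  have x_le: "\<bar>real (x w)\<bar> \<le> (a + 1) * sqrt W'" if "w \<in> {w1, w2, w3}" for w
  proof (rule power2_le_imp_le)
    have "x w ^ 2 \<le> (a + 1) * w"
      using range[OF that] W(1) xyz[OF that] by simp
    also have "\<dots> \<le> (a + 1) * ((a + 1) * W')"
      using range[OF that] by (intro mult_left_mono) (auto intro: order_trans[of _ "1 * W'"])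
    also have "\<dots> = (a + 1)\<^sup>2 * W'"
      by (simp only: power2_eq_square mult.assoc)
    finally have "real ((x w)\<^sup>2) \<le> real ((a + 1)\<^sup>2 * W')"
      by (simp only: of_nat_le_iff)
    thus "\<bar>real (x w)\<bar>\<^sup>2 \<le> ((a + 1) * sqrt W')\<^sup>2"
      by (simp add: power_mult_distrib)
  qed simp
  have sqrt_mono: "C / sqrt w \<le> C / sqrt W" if "w \<in> {w1, w2, w3}" "C \<ge> 0" for w C
    using range[OF that(1)] W(1) that(2) by (intro divide_left_mono) auto
  have eta: "\<bar>\<eta> w\<bar> \<le> (a + b) / sqrt W" if "w \<in> {w1, w2, w3}" for w
  proof -
    have "\<bar>\<eta> w\<bar> \<le> (a + b) / sqrt w"
      unfolding \<eta>_def of_nat_add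
      by (rule sqrt_combination_bound[where e = 1])
         (use pos W(1) range[OF that] reals[OF that] in auto)
    also have "\<dots> \<le> (a + b) / sqrt W"
      by (rule sqrt_mono[OF that]) simp
    finally show ?thesis .
  qed
  have zeta: "\<bar>\<zeta> w\<bar> \<le> (a + c) / sqrt W" if "w \<in> {w1, w2, w3}" for w
  proof -
    have "\<bar>\<zeta> w\<bar> \<le> (a + c) / sqrt w"
      unfolding \<zeta>_def of_nat_add
      by (rule sqrt_combination_bound[where e = e])
         (use pos e W(1) range[OF that] reals[OF that] in auto)
    also have "\<dots> \<le> (a + c) / sqrt W"
      by (rule sqrt_mono[OF that]) simp
    finally show ?thesis .
  qed
  define C where "C = 6 * (a + 1) * (a + b) * (a + c)"
  \<comment> \<open>A nonzero integer has absolute value at least 1. The upper bound has six Leibniz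
    terms, each with one factor of order \<open>sqrt W'\<close> and two of order
    \<open>1 / sqrt W\<close>.\<close>
  have "1 * 1 \<le> real a * \<bar>real_of_int det\<bar>"
    using pos \<open>det \<noteq> 0\<close> by (intro mult_mono) auto
  also have "\<dots> = \<bar>a * real_of_int det\<bar>"
    by (simp add: abs_mult)
  also have "\<dots> \<le> 6 * (((a + 1) * sqrt W') * ((a + b) / sqrt W * ((a + c) / sqrt W)))"
    unfolding det_eq by (rule det_bound; rule x_le eta zeta; simp)
  also have "\<dots> = C * sqrt W' / W"
    by (simp add: C_def field_simps)
  finally have "real W \<le> C * sqrt W'"
    using W(1) by (simp add: field_simps)
  hence "(real W)\<^sup>2 \<le> (C * sqrt W')\<^sup>2"
    by (rule power_mono) simp
  hence "real (W\<^sup>2) \<le> real (C\<^sup>2 * W')"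
    by (simp add: power_mult_distrib)
  thus ?thesis
    unfolding C_def by (simp only: of_nat_le_iff)
qed

section \<open>Counting bad terms in a window\<close>

text \<open>Three bad terms for one constraint would give W^2 <= C W' with W' <= K^M W, hence W <= C
  K^M, which fails once the window starts late enough.\<close>

lemma infinitely_many_avoiding_squares:
  fixes w :: "nat \<Rightarrow> nat" and F :: "(nat \<times> nat) set"
  assumes mono: "strict_mono w" and pos: "\<And>n. w n > 0" and growth: "\<And>n. w (Suc n) \<le> K * w n"
    and sq: "\<And>n. is_square (a * w n + 1)" "\<And>n. is_square (b * w n + 1)"
    and ab: "a > 0" "b > 0" "a \<noteq> b"
    and F: "finite F" "\<And>c e. (c, e) \<in> F \<Longrightarrow> c > 0 \<and> e \<le> 1 \<and> c \<noteq> a * e \<and> c \<noteq> b * e"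
  shows "infinite {n. \<forall>(c, e)\<in>F. \<not> is_square (c * w n + e)}"
  unfolding infinite_nat_iff_unbounded_le
proof
  fix N
  \<comment> \<open>The window \<open>{n0..n0 + M}\<close> has M + 1 terms, one more than the number
    of bad terms allowed.\<close>
  define M where "M = 2 * card F"
  define C where "C = (\<lambda>(c, e::nat). (6 * (a + 1) * (a + b) * (a + c))\<^sup>2)"
  \<comment> \<open>\<open>sum C F\<close> dominates every single \<open>C f\<close>, and n <= w n
    makes \<open>w n0\<close> exceed the bound from the gap estimate.\<close>
  define n0 where "n0 = max N (sum C F * K ^ M + 1)"
  define bad where "bad = (\<lambda>(c, e). {n\<in>{n0..n0 + M}. is_square (c * w n + e)})"
  have wpow: "w (n + j) \<le> K ^ j * w n" for n j
  proof (induction j)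
    case (Suc j)
    have "w (n + Suc j) \<le> K * w (n + j)"
      using growth[of "n + j"] by simp
    also have "\<dots> \<le> K * (K ^ j * w n)"
      using Suc by simp
    finally show ?case
      by (simp add: mult.assoc)
  qed simp
  have "card (bad f) \<le> 2" if f: "f \<in> F" for f
  proof (rule ccontr)
    obtain c e where ce: "f = (c, e)" by fastforce
    assume "\<not> card (bad f) \<le> 2"
    then obtain B where "B \<subseteq> bad f" "card B = 3"
      by (metis obtain_subset_with_card_n not_less_eq_eq numeral_2_eq_2 numeral_3_eq_3)
    then obtain i j k where ijk: "i \<in> bad f" "j \<in> bad f" "k \<in> bad f" "i \<noteq> j" "i \<noteq> k" "j \<noteq> k"
      by (auto simp: card_3_iff)
    have "(w n0)\<^sup>2 \<le> (6 * (a + 1) * (a + b) * (a + c))\<^sup>2 * w (n0 + M)"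
    proof (rule three_solutions_gap)
      show "c > 0" "e \<le> 1" "c \<noteq> a * e" "c \<noteq> b * e"
        using F(2) f ce by blast+
      show "w i \<in> {w n0..w (n0 + M)}" "w j \<in> {w n0..w (n0 + M)}" "w k \<in> {w n0..w (n0 + M)}"
        using ijk(1-3) strict_mono_less_eq[OF mono] by (auto simp: bad_def ce)
      show "w i \<noteq> w j" "w i \<noteq> w k" "w j \<noteq> w k"
        using ijk(4-6) strict_mono_eq[OF mono] by auto
      show "is_square (a * v + 1) \<and> is_square (b * v + 1) \<and> is_square (c * v + e)"
        if "v \<in> {w i, w j, w k}" for v
        using that ijk(1-3) sq by (auto simp: bad_def ce)
    qed (use ab pos in auto)
    also have "\<dots> = C f * w (n0 + M)"
      by (simp add: C_def ce)
    also have "\<dots> \<le> sum C F * (K ^ M * w n0)"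
      using member_le_sum[of f F C] f F(1) wpow[of n0 M] by (intro mult_mono) auto
    also have "\<dots> = sum C F * K ^ M * w n0"
      by simp
    finally have "w n0 \<le> sum C F * K ^ M"
      using pos[of n0] by (simp add: power2_eq_square)
    moreover have "n0 \<le> w n0"
      using mono by (rule strict_mono_imp_increasing)
    ultimately show False
      by (simp add: n0_def)
  qed
  hence "(\<Sum>f\<in>F. card (bad f)) \<le> (\<Sum>f\<in>F. 2)"
    by (rule sum_mono)
  hence "card (\<Union>f\<in>F. bad f) \<le> M"
    using card_UN_le[OF F(1), of bad] by (simp add: M_def)
  hence less: "card (\<Union>f\<in>F. bad f) < card {n0..n0 + M}"
    by simp
  have "\<not> {n0..n0 + M} \<subseteq> (\<Union>f\<in>F. bad f)"
  proof
    assume "{n0..n0 + M} \<subseteq> (\<Union>f\<in>F. bad f)"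
    moreover have "finite (\<Union>f\<in>F. bad f)"
      using F(1) by (auto simp: bad_def)
    ultimately show False
      using less by (meson card_mono not_le)
  qed
  then obtain n where "n \<in> {n0..n0 + M}" "n \<notin> (\<Union>f\<in>F. bad f)"
    by blast
  thus "\<exists>n\<ge>N. n \<in> {n. \<forall>(c, e)\<in>F. \<not> is_square (c * w n + e)}"
    by (intro exI[of _ n]) (auto simp: bad_def n0_def)
qed

section \<open>Vertices built from large primes\<close>

text \<open>The prime divides x - 1 or x + 1. If that factor is l p, the other is l p + 2 or l p -
  2; in the second case \<open>l\<close> is replaced by \<open>- l\<close>.\<close>

lemma prime_mult_plus_one_eq_square:
  fixes p q x :: nat
  assumes "prime p" "p * q + 1 = x\<^sup>2"
  obtains l :: int where "int q = l * (l * int p + 2)"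
proof -
  have p: "prime (int p)" "int p \<noteq> 0"
    using assms(1) by auto
  have "int (p * q + 1) = int (x\<^sup>2)"
    using assms(2) by simp
  hence eq: "int p * int q = (int x - 1) * (int x + 1)"
    by (simp add: power2_eq_square algebra_simps)
  hence "int p dvd (int x - 1) * (int x + 1)"
    by (metis dvd_triv_left)
  hence "int p dvd int x - 1 \<or> int p dvd int x + 1"
    using p(1) by (simp add: prime_dvd_mult_iff)
  thus thesis
  proof
    assume "int p dvd int x - 1"
    then obtain l where l: "int x - 1 = int p * l" ..
    hence "int p * int q = int p * (l * (l * int p + 2))"
      unfolding eq using l by (simp add: algebra_simps eq_diff_eq)
    thus thesis
      using that p(2) by simp
  next
    assume "int p dvd int x + 1"
    then obtain l where l: "int x + 1 = int p * l" ..
    hence x: "int x = int p * l - 1"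
      by simp
    have "int p * int q = int p * (- l * (- l * int p + 2))"
      unfolding eq x by (simp add: algebra_simps)
    thus thesis
      using that p(2) by (simp del: mult_minus_left)
  qed
qed

lemma not_square_prime_mult:
  fixes p u :: nat
  assumes "prime p" "\<not> p dvd u"
  shows "\<not> is_square (p * u)"
proof
  assume "is_square (p * u)"
  then obtain x where x: "p * u = x\<^sup>2"
    by (auto simp: is_nth_power_def)
  hence "p dvd x\<^sup>2"
    by (metis dvd_triv_left)
  hence "p dvd x"
    using assms(1) by (simp add: prime_dvd_power_iff)
  then obtain y where "x = p * y" ..
  with x have "p * u = p * (p * y\<^sup>2)"
    by (simp only: power2_eq_square mult_ac)
  hence "u = p * y\<^sup>2"
    using assms(1) by (auto simp: prime_gt_0_nat)
  with assms(2) show False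
    by simp
qed

lemma infinite_primes_greater: "infinite {p::nat. prime p \<and> p > n}"
proof -
  have "{p::nat. prime p \<and> p > n} = {p. prime p} - {..n}"
    by auto
  thus ?thesis
    using primes_infinite by simp
qed

text \<open>A link would give v = l (l p + 2) with l nonzero, so v >= |l p + 2| >= p - 2.\<close>

lemma prime_not_linked:
  fixes p v :: nat
  assumes "prime p" "p > v + 2" "v > 0"
  shows "\<not> is_square (p * v + 1)"
proof
  assume "is_square (p * v + 1)"
  then obtain x where "p * v + 1 = x\<^sup>2"
    by (auto simp: is_nth_power_def)
  with assms(1) obtain l where l: "int v = l * (l * int p + 2)"
    by (rule prime_mult_plus_one_eq_square)
  hence "l \<noteq> 0"
    using assms(3) by auto
  have "int p * 1 \<le> int p * \<bar>l\<bar>"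
    using \<open>l \<noteq> 0\<close> by (intro mult_left_mono) auto
  also have "\<dots> = \<bar>l * int p\<bar>"
    by (simp add: abs_mult)
  also have "\<dots> \<le> \<bar>l * int p + 2\<bar> + 2"
    by linarith
  also have "\<bar>l * int p + 2\<bar> \<le> \<bar>l\<bar> * \<bar>l * int p + 2\<bar>"
    using mult_right_mono[of 1 "\<bar>l\<bar>" "\<bar>l * int p + 2\<bar>"] \<open>l \<noteq> 0\<close> by simp
  also have "\<bar>l\<bar> * \<bar>l * int p + 2\<bar> = int v"
    using l by (metis abs_mult abs_of_nat)
  finally show False
    using assms(2) by simp
qed

text \<open>A link would give p (a b - l^2) = 2 (l - b). If both sides vanish, then l = b and a = b.
  Otherwise \<open>p\<close> is at most 2 (|l| + b), so it remains to bound
  \<open>l\<close>.\<close>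

lemma prime_family_not_linked:
  fixes p a b :: nat
  assumes p: "prime p" "p > 2 * (a * b + 4 * b + 4)" and pos: "a > 0" "b > 0" and ab: "a \<noteq> b"
  shows "\<not> is_square (p * (p * a + 2) * b + 1)"
proof
  assume "is_square (p * (p * a + 2) * b + 1)"
  then obtain x where "p * (p * a + 2) * b + 1 = x\<^sup>2"
    by (elim is_nth_powerE)
  hence "p * ((p * a + 2) * b) + 1 = x\<^sup>2"
    by (simp only: mult.assoc)
  with p(1) obtain l where l: "int ((p * a + 2) * b) = l * (l * int p + 2)"
    by (rule prime_mult_plus_one_eq_square)
  have eq: "int p * (int a * int b - l\<^sup>2) = 2 * (l - int b)"
    using l by (simp add: power2_eq_square algebra_simps)
  show False
  proof (cases "int a * int b = l\<^sup>2")
    case True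
    with eq have "l = int b"
      by simp
    with True pos ab show False
      by (simp add: power2_eq_square)
  next
    case False
    define d where "d = \<bar>int a * int b - l\<^sup>2\<bar>"
    have "d \<ge> 1"
      using False by (simp add: d_def)
    have pd: "int p * d \<le> 2 * (\<bar>l\<bar> + int b)"
    proof -
      have "int p * d = \<bar>2 * (l - int b)\<bar>"
        unfolding d_def eq[symmetric] by (simp add: abs_mult)
      thus ?thesis by simp
    qed
    \<comment> \<open>For larger |l| the quadratic growth of \<open>d\<close> gives d >= |l| + b,
      whereas p >= 4 gives 4 d <= 2 (|l| + b).\<close>
    have "\<bar>l\<bar> < int (a * b + 2 * b + 4)"
    proof (rule ccontr)
      define L where "L = \<bar>l\<bar>"
      assume "\<not> \<bar>l\<bar> < int (a * b + 2 * b + 4)"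
      hence L: "L \<ge> int a * int b + 2 * int b + 4"
        by (simp add: L_def)
      have "0 \<le> int a * int b"
        by simp
      with L have "4 \<le> L"
        by linarith
      hence "4 * L \<le> L * L"
        by (intro mult_right_mono) auto
      moreover have "L * L - int a * int b \<le> d"
        unfolding d_def by (simp add: L_def power2_eq_square)
      ultimately have "L + int b \<le> d"
        using L \<open>0 \<le> int a * int b\<close> by linarith
      moreover have "4 * d \<le> 2 * (L + int b)"
        unfolding L_def using p(2) \<open>d \<ge> 1\<close>
        by (intro order_trans[OF mult_right_mono pd]) auto
      ultimately show False
        using \<open>d \<ge> 1\<close> by presburger
    qed
    moreover have "int p * 1 \<le> int p * d"
      using \<open>d \<ge> 1\<close> by (intro mult_left_mono) auto
    with pd have "int p \<le> 2 * (\<bar>l\<bar> + int b)"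
      by linarith
    moreover have "int (2 * (a * b + 4 * b + 4)) < int p"
      using p(2) by (simp only: of_nat_less_iff)
    ultimately show False
      by simp
  qed
qed

section \<open>Assembling the three cases\<close>

lemma neighbours_diophantine_graph_insert:
  assumes "w \<notin> V"
  shows "neighbours (diophantine_graph (V \<union> {w})) w = {v\<in>V. is_square (w * v + 1)}"
  using assms unfolding neighbours_def diophantine_graph_def
  by auto

theorem theorem1:
  fixes V :: "nat set"
  assumes "finite V" and "\<forall>v\<in>V. v > 0"
  shows
    "infinite {w::nat. w > 0 \<and> (\<forall>v\<in>V. squarefree_part w \<noteq> squarefree_part v) \<and>
        isolated_vertex (diophantine_graph (V \<union> {w})) w} \<and>
     (\<forall>a\<in>V. infinite {w::nat. w > 0 \<and> (\<forall>v\<in>V. squarefree_part w \<noteq> squarefree_part v) \<and>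
        neighbours (diophantine_graph (V \<union> {w})) w = {a}}) \<and>
     (\<forall>a\<in>V. \<forall>b\<in>V. a \<noteq> b \<and> squarefree_part a \<noteq> squarefree_part b \<longrightarrow>
        infinite {w::nat. w > 0 \<and> (\<forall>v\<in>V. squarefree_part w \<noteq> squarefree_part v) \<and>
          neighbours (diophantine_graph (V \<union> {w})) w = {a, b}})"
proof -
  \<comment> \<open>The three claims are the cases where \<open>U\<close> is empty,
    \<open>{a}\<close> or \<open>{a, b}\<close>.\<close>
  define good where "good U = {w. w > 0 \<and> (\<forall>v\<in>V. squarefree_part w \<noteq> squarefree_part v) \<and>
      neighbours (diophantine_graph (V \<union> {w})) w = U}" for U
  have goodI: "w \<in> good U" if "w > 0" "\<And>v. v \<in> V \<Longrightarrow> \<not> is_square (w * v)" "U \<subseteq> V"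
    "\<And>v. v \<in> V \<Longrightarrow> is_square (w * v + 1) \<longleftrightarrow> v \<in> U" for w U
  proof -
    have sf: "\<forall>v\<in>V. squarefree_part w \<noteq> squarefree_part v"
      using that(1,2) assms(2) is_square_mult_iff_squarefree_part_eq by blast
    hence "w \<notin> V" by blast
    hence "neighbours (diophantine_graph (V \<union> {w})) w = U"
      unfolding neighbours_diophantine_graph_insert[OF \<open>w \<notin> V\<close>] using that(3,4) by auto
    thus ?thesis
      using that(1) sf by (simp add: good_def)
  qed
  obtain B where B: "\<And>v. v \<in> V \<Longrightarrow> v \<le> B"
    using assms(1) by (metis finite_nat_set_iff_bounded_le)
  have "infinite (good {})"
  proof (rule infinite_super[OF _ infinite_primes_greater[of "B + 2"]], safe)
    fix p :: nat assume p: "prime p" "p > B + 2"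
    show "p \<in> good {}"
    proof (rule goodI)
      fix v assume v: "v \<in> V"
      have "v > 0" "p > v + 2"
        using v assms(2) B[OF v] p(2) by auto
      then show "\<not> is_square (p * v)" "is_square (p * v + 1) \<longleftrightarrow> v \<in> {}"
        using not_square_prime_mult[OF p(1), of v] prime_not_linked[OF p(1), of v]
        by (auto simp: nat_dvd_not_less)
    qed (use p in auto)
  qed
  moreover have "infinite (good {a})" if a: "a \<in> V" for a
  proof -
    \<comment> \<open>The threshold of \<open>prime_family_not_linked\<close> at b = B, which serves
      all vertices at once.\<close>
    define P where "P = {p. prime p \<and> p > 2 * (a * B + 4 * B + 4)}"
    have a0: "a > 0"
      using a assms(2) by blast
    have "strict_mono (\<lambda>p. p * (p * a + 2))"
      by (rule strict_monoI, intro mult_strict_mono) (use a0 in simp_all)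
    hence "inj_on (\<lambda>p. p * (p * a + 2)) P"
      by (rule strict_mono_imp_inj_on)
    hence "infinite ((\<lambda>p. p * (p * a + 2)) ` P)"
      using infinite_primes_greater finite_imageD unfolding P_def by blast
    moreover have "(\<lambda>p. p * (p * a + 2)) ` P \<subseteq> good {a}"
    proof (rule image_subsetI, rule goodI)
      fix p assume "p \<in> P"
      hence p: "prime p" "p > 2 * (a * B + 4 * B + 4)"
        by (simp_all add: P_def)
      show "p * (p * a + 2) > 0"
        using p(2) by simp
      fix v assume v: "v \<in> V"
      have v0: "v > 0"
        using v assms(2) by blast
      have "2 * (a * v + 4 * v + 4) \<le> 2 * (a * B + 4 * B + 4)"
        using B[OF v] by (intro mult_le_mono add_le_mono) auto
      with p(2) have pv: "p > 2 * (a * v + 4 * v + 4)"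
        by (rule le_less_trans[rotated])
      hence pv': "p > v" "p > 2"
        by simp_all
      have "\<not> p dvd v"
        using pv'(1) v0 by (simp add: nat_dvd_not_less)
      \<comment> \<open>Otherwise p would divide 2. Hence \<open>p\<close> divides
        \<open>p * (p * a + 2) * v\<close> exactly once.\<close>
      moreover have "\<not> p dvd p * a + 2"
        using pv'(2) by (metis dvd_add_right_iff dvd_triv_left nat_dvd_not_less pos2)
      ultimately have "\<not> p dvd (p * a + 2) * v"
        using p(1) prime_dvd_multD by blast
      thus "\<not> is_square (p * (p * a + 2) * v)"
        unfolding mult.assoc by (rule not_square_prime_mult[OF p(1)])
      have "p * (p * a + 2) * a + 1 = (p * a + 1)\<^sup>2"
        by (simp add: power2_eq_square algebra_simps)
      hence "is_square (p * (p * a + 2) * a + 1)"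
        by (metis is_nth_power_nth_power)
      thus "is_square (p * (p * a + 2) * v + 1) \<longleftrightarrow> v \<in> {a}"
        using prime_family_not_linked[OF p(1) pv a0 v0] by auto
    qed (use a in auto)
    ultimately show ?thesis
      by (rule infinite_super[rotated])
  qed
  moreover have "infinite (good {a, b})"
    if ab: "a \<in> V" "b \<in> V" "a \<noteq> b" "squarefree_part a \<noteq> squarefree_part b" for a b
  proof -
    have pos: "a > 0" "b > 0"
      using ab assms(2) by auto
    with ab(4) have "\<not> is_square (a * b)"
      by (simp add: is_square_mult_iff_squarefree_part_eq)
    from common_neighbours_family[OF pos this] obtain w K where w: "strict_mono w"
      "\<And>n. w n > 0" "\<And>n. w (Suc n) \<le> K * w n" "\<And>n. is_square (a * w n + 1)"
      "\<And>n. is_square (b * w n + 1)"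
      by metis
    \<comment> \<open>Pairs with second entry 0 keep the square-free parts different; those with 1
      forbid links to vertices other than \<open>a\<close> and \<open>b\<close>.\<close>
    define F where "F = V \<times> {0} \<union> (V - {a, b}) \<times> {1::nat}"
    define I where "I = {n. \<forall>(c, e)\<in>F. \<not> is_square (c * w n + e)}"
    have "infinite I"
      unfolding I_def
      by (rule infinitely_many_avoiding_squares[OF w pos ab(3)])
         (use assms in \<open>auto simp: F_def\<close>)
    hence "infinite (w ` I)"
      using finite_imageD[of w I] strict_mono_imp_inj_on[OF w(1)] inj_on_subset[of w UNIV I] by blast
    moreover have "w ` I \<subseteq> good {a, b}"
    proof (rule image_subsetI, rule goodI)
      fix n assume "n \<in> I"
      hence avoid: "\<not> is_square (c * w n + e)" if "(c, e) \<in> F" for c e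
        using that by (auto simp: I_def)
      fix v assume v: "v \<in> V"
      show "\<not> is_square (w n * v)"
        using avoid[of v 0] v by (simp add: F_def mult.commute)
      show "is_square (w n * v + 1) \<longleftrightarrow> v \<in> {a, b}"
        using avoid[of v 1] v w(4,5)[of n] by (auto simp: F_def mult.commute)
    qed (use w(2) ab in auto)
    ultimately show ?thesis
      by (rule infinite_super[rotated])
  qed
  ultimately show ?thesis
    by (auto simp: good_def isolated_vertex_def diophantine_graph_def)
qed

end
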